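(* Let $q$ be a prime power, $n\ge1$, $\sigma$ a generator of $\mathrm{Gal}(\mathbb{F}_{q^n}/\mathbb{F}_q)$, and let $L=a_0x+a_1x^{\sigma}+\dots+a_dx^{\sigma^d}\in\mathbb{F}_{q^n}[x]$ have $\sigma$-degree $d\ge1$ and $a_0\neq0$. For $\lambda\in\mathbb{F}_q$ let $n_\lambda$ be the dimension of the eigenspace of $A_L$ with eigenvalue $\lambda$ (so $n_\lambda=0$ if $\lambda$ is not an eigenvalue). Then the number of roots of $P_L$ in $\mathbb{F}_{q^n}$ is $$\sum_{\lambda\in\mathbb{F}_q}\frac{q^{n_\lambda}-1}{q-1},$$ and the number of roots of $L$ in $\mathbb{F}_{q^n}$ is $q^{n_1}$.
   Context: $x^\sigma=x^{q^s}$ for some $s$ with $\gcd(s,n)=1$; for a matrix $M$ over $\mathbb{F}_{q^n}$, $M^{\sigma}$ denotes entrywise application of $\sigma$. For $y\in\mathbb{F}_{q^n}$, $y^{[i]}:=y^{1+\sigma+\dots+\sigma^{i-1}}$ ($y^{[0]}=1$). The projective polynomial associated to $L$ is $P_L(y)=\sum_{i=0}^d a_iy^{[i]}$. The companion matrix $C_L$ is the $d\times d$ matrix with $1$'s on the subdiagonal, last column $(-a_0/a_d,\dots,-a_{d-1}/a_d)^T$, zeros elsewhere, and $A_L:=C_LC_L^{\sigma}\cdots C_L^{\sigma^{n-1}}$. *)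

theory Defs
  imports
    "HOL-Number_Theory.Prime_Powers"
    "HOL-Algebra.Subrings"
    "Jordan_Normal_Form.Matrix_Kernel"
    "Jordan_Normal_Form.Char_Poly"
begin

definition frob :: "nat \<Rightarrow> nat \<Rightarrow> 'a :: field \<Rightarrow> 'a" where
  "frob q s x = x ^ (q ^ s)"

text \<open>
  A coefficient sequence \<open>a\<close>, of which only \<open>a 0, \<dots>, a d\<close> matter, represents
  \<open>L = a 0 * x + a 1 * x^\<sigma> + \<dots> + a d * x^(\<sigma>^d)\<close>, where \<open>\<sigma> = frob q s\<close>, so that
  \<open>x^(\<sigma>^i) = x ^ (q ^ (s * i))\<close>.
\<close>

definition lin_poly :: "nat \<Rightarrow> nat \<Rightarrow> nat \<Rightarrow> (nat \<Rightarrow> 'a :: field) \<Rightarrow> 'a poly" where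
  "lin_poly q s d a = (\<Sum>i\<le>d. Polynomial.monom (a i) (q ^ (s * i)))"

text \<open>The exponent \<open>[i] = 1 + \<sigma> + \<dots> + \<sigma>^(i-1)\<close>, read as a natural number.\<close>

definition br_exp :: "nat \<Rightarrow> nat \<Rightarrow> nat \<Rightarrow> nat" where
  "br_exp q s i = (\<Sum>j<i. q ^ (s * j))"

definition proj_poly :: "nat \<Rightarrow> nat \<Rightarrow> nat \<Rightarrow> (nat \<Rightarrow> 'a :: field) \<Rightarrow> 'a poly" where
  "proj_poly q s d a = (\<Sum>i\<le>d. Polynomial.monom (a i) (br_exp q s i))"

definition companion :: "nat \<Rightarrow> (nat \<Rightarrow> 'a :: field) \<Rightarrow> 'a mat" where
  "companion d a = mat d d (\<lambda>(i, j).
     if j = d - 1 then - (a i / a d) else if i = j + 1 then 1 else 0)"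

text \<open>The ordered product \<open>C * C^\<sigma> * \<dots> * C^(\<sigma>^(n-1))\<close>, where \<open>C = companion d a\<close>.\<close>

definition A_mat :: "nat \<Rightarrow> nat \<Rightarrow> nat \<Rightarrow> nat \<Rightarrow> (nat \<Rightarrow> 'a :: field) \<Rightarrow> 'a mat" where
  "A_mat q n s d a =
     foldr (*) (map (\<lambda>i. map_mat (frob q s ^^ i) (companion d a)) [0..<n]) (1\<^sub>m d)"

definition eigenspace :: "'a :: field mat \<Rightarrow> 'a \<Rightarrow> 'a vec set" where
  "eigenspace A k = {v \<in> carrier_vec (dim_row A). A *\<^sub>v v = k \<cdot>\<^sub>v v}"

text \<open>The dimension is taken over the full field of matrix entries.\<close>

definition eigenspace_dim :: "'a :: field mat \<Rightarrow> 'a \<Rightarrow> nat" where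
  "eigenspace_dim A k = vectorspace.dim class_ring
     (module_vec TYPE('a) (dim_row A) \<lparr>carrier := eigenspace A k\<rparr>)"

end

(*
  Let sigma be the Frobenius map and tau its inverse. For nonzero y, the map
  Psi(u) = tau(u C / y) on row vectors is tau-semilinear, and Psi^n(u) = u A / N(y), where N is the
  norm. Its fixed vectors are u = (y^[i] sigma^i(x))_{i<d}, where x is a root of
  L_y(x) = sum_i a_i y^[i] sigma^i(x). By Galois descent, the number of
  fixed points of Psi is the n-th root of that of Psi^n, whose fixed points are the left eigenvectors of A for
  N(y); hence L_y has q^(n_{N(y)}) roots. The case y = 1 is the claim on L.

  For x nonzero, L_y(x) = x P_L(y sigma(x) / x). Counting the pairs of nonzero (y, x) with
  L_y(x) = 0 in two ways gives (q^n - 1) |roots of P_L| = sum_{y nonzero} (q^(n_{N(y)}) - 1), and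
  every nonzero element of F_q is the norm of (q^n - 1)/(q - 1) elements (Hilbert 90).
*)

theory Submission
  imports Defs "HOL-Library.Function_Algebras"
begin

section \<open>Linear algebra over finite fields\<close>

text \<open>Coordinates in a finite basis identify the space with the functions from the basis to
  the scalars. Dimensions thus become cardinalities, in which all later comparisons are
  made.\<close>

lemma card_vectorspace:
  assumes "vectorspace K V" "finite (carrier K)" "finite (carrier V)"
  shows "card (carrier V) = card (carrier K) ^ vectorspace.dim K V"
proof -
  interpret vectorspace K V by fact
  have "fin_dim"
    unfolding fin_dim_def using assms(3) by (intro exI[of _ "carrier V"]) (auto intro: in_own_span[THEN subsetD] span_is_subset2[THEN subsetD])
  then obtain B where B: "finite B" "basis B"
    using finite_basis_exists by auto
  have BV: "B \<subseteq> carrier V" using B(2) by (simp add: basis_def)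
  have ex1: "\<exists>!a. a \<in> B \<rightarrow>\<^sub>E carrier K \<and> lincomb a B = v" if "v \<in> carrier V" for v
    using B(2) basis_criterion[OF B(1) BV] that by blast
  have "bij_betw (\<lambda>a. lincomb a B) (B \<rightarrow>\<^sub>E carrier K) (carrier V)"
    unfolding bij_betw_def
  proof
    show "inj_on (\<lambda>a. lincomb a B) (B \<rightarrow>\<^sub>E carrier K)"
      using ex1 BV by (intro inj_onI) (metis lincomb_closed Pi_I' PiE_mem)
    show "(\<lambda>a. lincomb a B) ` (B \<rightarrow>\<^sub>E carrier K) = carrier V"
    proof
      show "(\<lambda>a. lincomb a B) ` (B \<rightarrow>\<^sub>E carrier K) \<subseteq> carrier V"
        using BV by (auto intro!: lincomb_closed)
      show "carrier V \<subseteq> (\<lambda>a. lincomb a B) ` (B \<rightarrow>\<^sub>E carrier K)"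
        using ex1 by blast
    qed
  qed
  then have "card (carrier V) = card (B \<rightarrow>\<^sub>E carrier K)"
    by (simp add: bij_betw_same_card)
  then show ?thesis
    using B dim_basis[OF B] by (simp add: card_PiE)
qed

text \<open>A kernel vector lists the coefficients of a polynomial of degree below \<open>n\<close>
  with \<open>n\<close> distinct roots.\<close>

lemma det_vandermonde_nonzero:
  fixes x :: "nat \<Rightarrow> 'a :: field"
  assumes "inj_on x {..<n}"
  shows "det (mat n n (\<lambda>(k, j). x k ^ j)) \<noteq> 0"
proof
  let ?A = "mat n n (\<lambda>(k, j). x k ^ j)"
  assume "det ?A = 0"
  then obtain v where v: "v \<in> carrier_vec n" "v \<noteq> 0\<^sub>v n" "?A *\<^sub>v v = 0\<^sub>v n"
    using det_0_iff_vec_prod_zero_field[of ?A n] by auto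
  have n: "n > 0" using v by (cases n) auto
  define p where "p = (\<Sum>j<n. Polynomial.monom (v $ j) j)"
  have coeff: "coeff p j = (if j < n then v $ j else 0)" for j
    by (simp add: p_def coeff_sum)
  have deg: "degree p < n"
    using n by (metis coeff degree_less_if_less_eqI gr0I le_degree leading_coeff_0_iff not_le degree_0)
  have root: "poly p (x k) = 0" if "k < n" for k
  proof -
    have "0 = (?A *\<^sub>v v) $ k" using v(3) that by simp
    also have "\<dots> = (\<Sum>j<n. x k ^ j * v $ j)"
      using v(1) that by (simp add: scalar_prod_def atLeast0LessThan)
    also have "\<dots> = poly p (x k)"
      by (simp add: p_def poly_sum poly_monom mult.commute)
    finally show ?thesis by simp
  qed
  have "p = 0"
  proof (rule ccontr)
    assume p: "p \<noteq> 0"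
    have "x ` {..<n} \<subseteq> {z. poly p z = 0}" using root by auto
    then have "card (x ` {..<n}) \<le> degree p"
      using card_poly_roots_bound[OF p] poly_roots_finite[OF p] card_mono order_trans by blast
    then show False using deg assms by (simp add: card_image)
  qed
  then have "v $ j = 0" if "j < n" for j
    using coeff[of j] that by simp
  then have "v = 0\<^sub>v n" using v(1) by auto
  with v(2) show False by simp
qed

text \<open>The elements counted are roots of \<open>X^k - X\<close>; \<open>k \<ge> 2\<close> makes
  this polynomial nonzero.\<close>

lemma card_power_fixed_le:
  assumes "k \<ge> 2"
  shows "card {x :: 'a :: field. x ^ k = x} \<le> k"
proof -
  let ?p = "Polynomial.monom 1 k - Polynomial.monom (1 :: 'a) 1"
  have "coeff ?p k = 1" using assms by simp
  then have p: "?p \<noteq> 0" by (metis coeff_0 zero_neq_one)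
  have "degree ?p \<le> k"
    using assms degree_monom_le[of "1 :: 'a"] by (intro degree_diff_le) (auto simp: degree_monom_eq)
  moreover have "{x. x ^ k = x} = {x. poly ?p x = 0}"
    by (simp add: poly_monom)
  ultimately show ?thesis
    using card_poly_roots_bound[OF p] by simp
qed

lemma finite_carrier_vec: "finite (carrier_vec d :: 'a :: finite vec set)"
proof -
  have "carrier_vec d \<subseteq> (\<lambda>f. vec d f) ` ({..<d} \<rightarrow>\<^sub>E (UNIV :: 'a set))"
  proof
    fix v :: "'a vec" assume "v \<in> carrier_vec d"
    then show "v \<in> (\<lambda>f. vec d f) ` ({..<d} \<rightarrow>\<^sub>E UNIV)"
      by (intro image_eqI[of _ _ "restrict (\<lambda>i. v $ i) {..<d}"]) auto
  qed
  then show ?thesis by (rule finite_subset) (intro finite_imageI finite_PiE; simp)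
qed

text \<open>Once \<open>w \<bullet> e = 1\<close>, every vector is uniquely \<open>v + c e\<close>
  with \<open>v\<close> in the hyperplane, namely with \<open>c\<close> its product with
  \<open>w\<close>.\<close>

lemma card_hyperplane:
  fixes w :: "'a :: {field, finite} vec"
  assumes w: "w \<in> carrier_vec d" "w \<noteq> 0\<^sub>v d"
  shows "card (UNIV :: 'a set) * card {v \<in> carrier_vec d. w \<bullet> v = 0} = card (carrier_vec d :: 'a vec set)"
proof -
  obtain j where j: "j < d" "w $ j \<noteq> 0"
    using w by (metis carrier_vecD eq_vecI index_zero_vec(1) index_zero_vec(2))
  define e where "e = inverse (w $ j) \<cdot>\<^sub>v unit_vec d j"
  have e: "e \<in> carrier_vec d" "w \<bullet> e = 1"
    using w j by (auto simp: e_def)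
  let ?S = "{v \<in> carrier_vec d. w \<bullet> v = 0}"
  have "card ((UNIV :: 'a set) \<times> ?S) = card (carrier_vec d :: 'a vec set)"
  proof (rule bij_betw_same_card[of "\<lambda>(c, v). v + c \<cdot>\<^sub>v e"],
      rule bij_betw_byWitness[where f' = "\<lambda>v. (w \<bullet> v, v - (w \<bullet> v) \<cdot>\<^sub>v e)"])
    show "\<forall>p\<in>UNIV \<times> ?S. (\<lambda>v. (w \<bullet> v, v - (w \<bullet> v) \<cdot>\<^sub>v e)) ((\<lambda>(c, v). v + c \<cdot>\<^sub>v e) p) = p"
    proof
      fix p assume "p \<in> (UNIV :: 'a set) \<times> ?S"
      then obtain c v where p: "p = (c, v)" "v \<in> carrier_vec d" "w \<bullet> v = 0" by auto
      then have "w \<bullet> (v + c \<cdot>\<^sub>v e) = c"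
        using w e by (simp add: scalar_prod_add_distrib)
      moreover have "v + c \<cdot>\<^sub>v e - c \<cdot>\<^sub>v e = v" using p e by auto
      ultimately show "(\<lambda>v. (w \<bullet> v, v - (w \<bullet> v) \<cdot>\<^sub>v e)) ((\<lambda>(c, v). v + c \<cdot>\<^sub>v e) p) = p"
        by (simp add: p)
    qed
    show "\<forall>v\<in>carrier_vec d. (\<lambda>(c, v). v + c \<cdot>\<^sub>v e) (w \<bullet> v, v - (w \<bullet> v) \<cdot>\<^sub>v e) = v"
      using e by auto
    show "(\<lambda>(c, v). v + c \<cdot>\<^sub>v e) ` (UNIV \<times> ?S) \<subseteq> carrier_vec d"
      using e by auto
    show "(\<lambda>v. (w \<bullet> v, v - (w \<bullet> v) \<cdot>\<^sub>v e)) ` carrier_vec d \<subseteq> UNIV \<times> ?S"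
      using w e by (auto simp: scalar_prod_minus_distrib)
  qed
  then show ?thesis by (simp add: card_cartesian_product)
qed

text \<open>Both sides are read off from the number of pairs \<open>(u, v)\<close> with \<open>B u \<bullet> v = 0\<close>.\<close>

lemma card_mat_kernel_transpose:
  fixes B :: "'a :: {field, finite} mat"
  assumes B: "B \<in> carrier_mat d d"
  shows "card (mat_kernel (transpose_mat B)) = card (mat_kernel B)"
proof -
  let ?V = "carrier_vec d :: 'a vec set" and ?Q = "card (UNIV :: 'a set)"
  have fin: "finite ?V" by (rule finite_carrier_vec)
  have pos: "card ?V > 0" using fin zero_carrier_vec[of d] by (auto simp: card_gt_0_iff simp del: zero_carrier_vec)
  \<comment> \<open>For fixed \<open>u\<close>, the admissible \<open>v\<close> form the whole space
    if \<open>M u = 0\<close> and a hyperplane otherwise, so the number of pairs determines the size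
    of the kernel.\<close>
  have count: "?Q * card {(u, v). u \<in> ?V \<and> v \<in> ?V \<and> (M *\<^sub>v u) \<bullet> v = 0}
      = card ?V * card ?V + card (mat_kernel M) * ((?Q - 1) * card ?V)"
    if M: "M \<in> carrier_mat d d" for M :: "'a mat"
  proof -
    have "{(u, v). u \<in> ?V \<and> v \<in> ?V \<and> (M *\<^sub>v u) \<bullet> v = 0} = Sigma ?V (\<lambda>u. {v \<in> ?V. (M *\<^sub>v u) \<bullet> v = 0})"
      by auto
    then have "?Q * card {(u, v). u \<in> ?V \<and> v \<in> ?V \<and> (M *\<^sub>v u) \<bullet> v = 0}
        = (\<Sum>u\<in>?V. ?Q * card {v \<in> ?V. (M *\<^sub>v u) \<bullet> v = 0})"
      using fin by (simp add: sum_distrib_left)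
    also have "\<dots> = (\<Sum>u\<in>?V. card ?V + (if u \<in> mat_kernel M then (?Q - 1) * card ?V else 0))"
    proof (rule sum.cong)
      fix u assume u: "u \<in> ?V"
      have Mu: "M *\<^sub>v u \<in> ?V" using M u by simp
      show "?Q * card {v \<in> ?V. (M *\<^sub>v u) \<bullet> v = 0} = card ?V + (if u \<in> mat_kernel M then (?Q - 1) * card ?V else 0)"
      proof (cases "u \<in> mat_kernel M")
        case True
        then have "{v \<in> ?V. (M *\<^sub>v u) \<bullet> v = 0} = ?V" using mat_kernelD[OF M True] by auto
        then have "?Q * card {v \<in> ?V. (M *\<^sub>v u) \<bullet> v = 0} = ?Q * card ?V" by simp
        also have "\<dots> = card ?V + (?Q - 1) * card ?V"
          using finite_UNIV_card_ge_0[where 'a = 'a] by (cases ?Q) auto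
        finally show ?thesis using True by simp
      next
        case False
        then have "M *\<^sub>v u \<noteq> 0\<^sub>v d" using mat_kernelI[OF M u] by auto
        with False show ?thesis using card_hyperplane[OF Mu] by simp
      qed
    qed simp
    also have "\<dots> = card ?V * card ?V + (\<Sum>u\<in>?V. if u \<in> mat_kernel M then (?Q - 1) * card ?V else 0)"
      by (simp add: sum.distrib)
    also have "(\<Sum>u\<in>?V. if u \<in> mat_kernel M then (?Q - 1) * card ?V else 0) = card (?V \<inter> mat_kernel M) * ((?Q - 1) * card ?V)"
      using fin by (simp add: sum.inter_restrict[symmetric])
    also have "?V \<inter> mat_kernel M = mat_kernel M" using mat_kernelD(1)[OF M] by auto
    finally show ?thesis .
  qed
  \<comment> \<open>Adjointness, \<open>B u \<bullet> v = B^T v \<bullet> u\<close>, makes swapping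
    the two vectors a bijection.\<close>
  have "bij_betw prod.swap {(u, v). u \<in> ?V \<and> v \<in> ?V \<and> (B *\<^sub>v u) \<bullet> v = 0}
     {(u, v). u \<in> ?V \<and> v \<in> ?V \<and> (transpose_mat B *\<^sub>v u) \<bullet> v = 0}"
  proof (rule bij_betw_byWitness[where f' = prod.swap])
    have adj: "(transpose_mat B *\<^sub>v v) \<bullet> u = (B *\<^sub>v u) \<bullet> v" if "u \<in> ?V" "v \<in> ?V" for u v
      using transpose_vec_mult_scalar[OF B that]
        comm_scalar_prod[OF mult_mat_vec_carrier[OF B that(1)] that(2)] by simp
    show "prod.swap ` {(u, v). u \<in> ?V \<and> v \<in> ?V \<and> (B *\<^sub>v u) \<bullet> v = 0}
      \<subseteq> {(u, v). u \<in> ?V \<and> v \<in> ?V \<and> (transpose_mat B *\<^sub>v u) \<bullet> v = 0}"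
      using adj by auto
    show "prod.swap ` {(u, v). u \<in> ?V \<and> v \<in> ?V \<and> (transpose_mat B *\<^sub>v u) \<bullet> v = 0}
      \<subseteq> {(u, v). u \<in> ?V \<and> v \<in> ?V \<and> (B *\<^sub>v u) \<bullet> v = 0}"
      using adj by auto
  qed auto
  from bij_betw_same_card[OF this] count[OF B] count[of "transpose_mat B"] B
  have "card (mat_kernel (transpose_mat B)) * ((?Q - 1) * card ?V) = card (mat_kernel B) * ((?Q - 1) * card ?V)"
    by simp
  moreover have "?Q > 1"
    using card_mono[of UNIV "{0, 1 :: 'a}"] by simp
  ultimately show ?thesis using pos by simp
qed

section \<open>Eigenspaces and their cardinalities\<close>

lemma eigenspace_eq_kernel:
  assumes A: "A \<in> carrier_mat d d"
  shows "eigenspace A k = mat_kernel (A - k \<cdot>\<^sub>m 1\<^sub>m d)"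
proof -
  have "A *\<^sub>v v = k \<cdot>\<^sub>v v \<longleftrightarrow> (A - k \<cdot>\<^sub>m 1\<^sub>m d) *\<^sub>v v = 0\<^sub>v d" if v: "v \<in> carrier_vec d" for v
  proof -
    have "(A - k \<cdot>\<^sub>m 1\<^sub>m d) *\<^sub>v v = A *\<^sub>v v - k \<cdot>\<^sub>v v"
      using A v by (subst minus_mult_distrib_mat_vec[of _ d d]) auto
    then show ?thesis using A v by (auto simp: vec_eq_iff)
  qed
  then show ?thesis using A by (auto simp: eigenspace_def mat_kernel_def)
qed

text \<open>Transposition commutes with subtracting \<open>k\<close> times the identity, so the
  kernel count applies. It trades the left eigenvectors that descent produces for right
  ones.\<close>

lemma card_eigenspace_transpose:
  fixes A :: "'a :: {field, finite} mat"
  assumes A: "A \<in> carrier_mat d d"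
  shows "card (eigenspace (transpose_mat A) k) = card (eigenspace A k)"
proof -
  have "transpose_mat (A - k \<cdot>\<^sub>m 1\<^sub>m d) = transpose_mat A - k \<cdot>\<^sub>m 1\<^sub>m d"
    using A by (intro eq_matI) auto
  moreover have "A - k \<cdot>\<^sub>m 1\<^sub>m d \<in> carrier_mat d d"
    by (intro minus_carrier_mat) simp
  ultimately show ?thesis
    using card_mat_kernel_transpose[of "A - k \<cdot>\<^sub>m 1\<^sub>m d" d] A
    by (simp add: eigenspace_eq_kernel[of _ d])
qed

lemma card_eigenspace:
  fixes A :: "'a :: {field, finite} mat"
  assumes dim: "A \<in> carrier_mat d d"
  shows "card (eigenspace A k) = card (UNIV :: 'a set) ^ eigenspace_dim A k"
proof -
  interpret kernel d d "A - k \<cdot>\<^sub>m 1\<^sub>m d" 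
    by unfold_locales (intro minus_carrier_mat, simp)
  have "finite (eigenspace A k)"
    by (rule finite_subset[OF _ finite_carrier_vec[of "dim_row A"]]) (auto simp: eigenspace_def)
  then show ?thesis
    using card_vectorspace[OF Ker.vectorspace_axioms] carrier_matD(1)[OF dim]
    by (simp add: eigenspace_eq_kernel[OF dim] eigenspace_dim_def)
qed

text \<open>Associativity carries the initial value of the fold out as a last factor. The carrier
  claim joins the induction because associativity needs it.\<close>

lemma foldr_mult_mat:
  assumes "\<And>x. x \<in> set xs \<Longrightarrow> x \<in> carrier_mat d d" "B \<in> carrier_mat d d"
  shows "foldr (*) xs B = foldr (*) xs (1\<^sub>m d) * (B :: 'a :: semiring_1 mat)
    \<and> foldr (*) xs (1\<^sub>m d) \<in> carrier_mat d d"
  using assms(1)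
proof (induction xs)
  case (Cons x xs)
  then have "x \<in> carrier_mat d d" by simp
  with Cons show ?case
    using assms(2) by (auto simp: assoc_mult_mat[of _ d d _ d _ d] intro!: mult_carrier_mat[of _ d d])
qed (use assms(2) in auto)

section \<open>Frobenius maps and Galois descent\<close>

text \<open>Multiplication by a nonzero \<open>x\<close> permutes \<open>F - {0}\<close>; comparing
  the products of all elements gives \<open>x ^ (card F - 1) = 1\<close>.\<close>

lemma subfield_power_card:
  fixes F :: "'a :: {field, finite} set"
  assumes "subfield F (class_ring :: 'a ring)" "x \<in> F"
  shows "x ^ card F = x"
proof (cases "x = 0")
  case True
  have "(1 :: 'a) \<in> F"
    using subringE(3)[of F class_ring] subfieldE(1)[OF assms(1)] by (simp add: subcring_def)
  then have "card F > 0" by (auto simp: card_gt_0_iff)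
  then show ?thesis using True by simp
next
  case False
  have sub: "subring F (class_ring :: 'a ring)"
    using subfieldE(1)[OF assms(1)] by (simp add: subcring_def)
  have "(\<lambda>y. x * y) ` (F - {0}) \<subseteq> F - {0}"
    using subringE(6)[OF sub] False assms(2) by auto
  then have im: "(\<lambda>y. x * y) ` (F - {0}) = F - {0}"
    by (intro endo_inj_surj) (auto intro: inj_onI simp: False)
  have "\<Prod>(F - {0}) = \<Prod>((\<lambda>y. x * y) ` (F - {0}))" by (simp only: im)
  also have "\<dots> = x ^ card (F - {0}) * \<Prod>(F - {0})"
    by (subst prod.reindex) (auto intro: inj_onI simp: False prod.distrib)
  finally have "x ^ card (F - {0}) = 1" by simp
  then have "x ^ Suc (card F - 1) = x"
    using subringE(2)[OF sub] by (simp add: card_Diff_singleton)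
  moreover have "card F \<noteq> 0" using assms(2) by auto
  ultimately show ?thesis by simp
qed

text \<open>Interpreted for the given \<open>s\<close> and also for the exponent
  \<open>s_inv\<close> of the inverse Frobenius, so that descent is available for both. The token
  \<open>K\<close> fixes the field type.\<close>

locale frobenius_field =
  fixes q n s :: nat and K :: "'a :: {field, finite} itself"
  assumes q: "primepow q"
    and n: "n \<ge> 1"
    and card_field: "card (UNIV :: 'a set) = q ^ n"
    and coprime: "coprime s n"
begin

abbreviation \<sigma> :: "'a \<Rightarrow> 'a" where "\<sigma> \<equiv> frob q s"

lemma q_ge_2: "q \<ge> 2"
  using primepow_gt_Suc_0[OF q] by simp

lemma power_card [simp]: "(x :: 'a) ^ (q ^ n) = x"
proof (cases "x = 0")
  case False
  have "(\<Prod>y\<in>UNIV - {0}. x * y) = (\<Prod>y\<in>UNIV - {0}. y)"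
    by (rule prod.reindex_bij_witness[of _ "\<lambda>y. y / x" "\<lambda>y. x * y"]) (use False in auto)
  then have "x ^ card (UNIV - {0 :: 'a}) = 1"
    by (simp add: prod.distrib)
  then have "x ^ Suc (q ^ n - 1) = x"
    by (simp add: card_field card_Diff_singleton)
  then show ?thesis using q_ge_2 by simp
qed (use q_ge_2 in simp)

text \<open>Translation by 1 permutes the field, so the characteristic divides the order of the
  field and is the prime below \<open>q\<close>. Additivity of the Frobenius maps rests on
  this.\<close>

lemma q_char: "\<exists>k. q = CHAR('a) ^ k"
proof -
  obtain p k where p: "prime p" "k > 0" "q = p ^ k"
    using q by (auto simp: primepow_def)
  have char: "prime CHAR('a)"
    using prime_CHAR_semidom finite_imp_CHAR_pos by (metis finite_class.finite_UNIV)
  have "(\<Sum>x\<in>(UNIV :: 'a set). x + 1) = (\<Sum>x\<in>UNIV. x)"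
    by (rule sum.reindex_bij_witness[of _ "\<lambda>x. x - 1" "\<lambda>x. x + 1"]) auto
  then have "of_nat (card (UNIV :: 'a set)) = (0 :: 'a)"
    by (simp add: sum.distrib)
  then have "CHAR('a) dvd p ^ (k * n)"
    by (simp only: of_nat_eq_0_iff_char_dvd card_field p power_mult)
  then have "CHAR('a) = p"
    using p(1) char by (meson prime_dvd_power primes_dvd_imp_eq)
  then show ?thesis using p by auto
qed

lemma frob_add: "frob q t (x + y) = frob q t x + frob q t (y :: 'a)"
proof -
  obtain k where "q ^ t = CHAR('a) ^ (k * t)" using q_char by (metis power_mult)
  moreover have "prime CHAR('a)"
    using prime_CHAR_semidom finite_imp_CHAR_pos by (metis finite_class.finite_UNIV)
  ultimately show ?thesis unfolding frob_def using freshmans_dream' by blast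
qed

lemma frob_0 [simp]: "frob q t (0 :: 'a) = 0"
  using q_ge_2 by (simp add: frob_def)

lemma frob_1 [simp]: "frob q t (1 :: 'a) = 1"
  by (simp add: frob_def)

lemma frob_mult: "frob q t (x * y :: 'a) = frob q t x * frob q t y"
  by (simp add: frob_def power_mult_distrib)

lemma frob_divide: "frob q t (x / y :: 'a) = frob q t x / frob q t y"
  by (simp add: frob_def power_divide)

lemma frob_eq_0_iff [simp]: "frob q t (x :: 'a) = 0 \<longleftrightarrow> x = 0"
  using q_ge_2 by (simp add: frob_def)

lemma frob_sum: "frob q t (\<Sum>i\<in>I. f i) = (\<Sum>i\<in>I. frob q t (f i :: 'a))"
  by (induction I rule: infinite_finite_induct) (auto simp: frob_add)

lemma frob_prod: "frob q t (\<Prod>i\<in>I. f i) = (\<Prod>i\<in>I. frob q t (f i :: 'a))"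
  by (induction I rule: infinite_finite_induct) (auto simp: frob_mult)

lemma frob_frob: "frob q t (frob q u x) = frob q (t + u) (x :: 'a)"
  by (simp add: frob_def power_add mult.commute flip: power_mult)

lemma funpow_frob: "(frob q t ^^ i) x = frob q (t * i) (x :: 'a)"
  by (induction i) (auto simp: frob_frob, simp add: frob_def)

lemma power_card_mod: "(x :: 'a) ^ (q ^ m) = x ^ (q ^ (m mod n))"
proof -
  have "x ^ (q ^ (n * t)) = x" for t
    by (induction t) (auto simp: power_add power_mult)
  moreover have "q ^ m = q ^ (n * (m div n)) * q ^ (m mod n)"
    by (simp flip: power_add)
  ultimately show ?thesis by (simp add: power_mult)
qed

lemma frob_multiple_n [simp]: "frob q (t * n) x = (x :: 'a)"
  by (simp add: frob_def power_card_mod[of _ "t * n"])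

lemma frob_eq_iff [simp]: "frob q t x = frob q t y \<longleftrightarrow> x = (y :: 'a)"
proof
  assume "frob q t x = frob q t y"
  then have "frob q (t * (n - 1)) (frob q t x) = frob q (t * (n - 1)) (frob q t y)" by simp
  moreover have "t * (n - 1) + t = t * n" using n by (cases n) auto
  ultimately show "x = y" by (simp add: frob_frob)
qed simp

text \<open>Otherwise every element would be fixed by some power map \<open>q ^ j\<close> with
  \<open>1 \<le> j < n\<close>, but these fixed sets have at most
  \<open>q + ... + q^(n-1) < q^n\<close> elements altogether.\<close>

lemma ex_inj_conjugates: "\<exists>g. inj_on (\<lambda>k. (\<sigma> ^^ k) g) {..<n}"
proof (rule ccontr)
  assume H: "\<not> ?thesis"
  have "\<exists>j\<in>{1..<n}. g ^ (q ^ j) = g" for g :: 'a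
  proof -
    have "\<not> inj_on (\<lambda>k. (\<sigma> ^^ k) g) {..<n}" using H by blast
    then obtain i j where ij: "i < n" "j < n" "i \<noteq> j" "(\<sigma> ^^ i) g = (\<sigma> ^^ j) g"
      by (auto simp: inj_on_def)
    define k l where "k = min i j" and "l = max i j"
    have kl: "k < l" "l < n" "(\<sigma> ^^ k) g = (\<sigma> ^^ l) g"
      using ij by (auto simp: k_def l_def min_def max_def)
    have inj: "(\<sigma> ^^ k) x = (\<sigma> ^^ k) y \<Longrightarrow> x = y" for x y
      by (induction k arbitrary: x y) auto
    have "(\<sigma> ^^ k) ((\<sigma> ^^ (l - k)) g) = (\<sigma> ^^ k) g"
      using kl by (metis comp_apply funpow_add le_add_diff_inverse less_imp_le)
    then have "(\<sigma> ^^ (l - k)) g = g" by (rule inj)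
    then have fixed: "g ^ (q ^ (s * (l - k) mod n)) = g"
      by (simp add: funpow_frob frob_def power_card_mod[of g "s * (l - k)", symmetric])
    \<comment> \<open>As \<open>s\<close> is coprime to \<open>n\<close> and
      \<open>0 < l - k < n\<close>, the exponent stays nonzero modulo \<open>n\<close>.\<close>
    have "\<not> n dvd s * (l - k)"
      using coprime kl coprime_dvd_mult_right_iff[of n s "l - k"] dvd_imp_le[of n "l - k"]
      by (auto simp: coprime_commute)
    then have "s * (l - k) mod n \<in> {1..<n}"
      using n by (simp add: Suc_le_eq mod_greater_zero_iff_not_dvd)
    with fixed show ?thesis by blast
  qed
  then have "(UNIV :: 'a set) = (\<Union>j\<in>{1..<n}. {g. g ^ (q ^ j) = g})" by auto
  then have "card (UNIV :: 'a set) \<le> (\<Sum>j\<in>{1..<n}. card {g :: 'a. g ^ (q ^ j) = g})"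
    by (elim ssubst) (rule card_UN_le, simp)
  also have "\<dots> \<le> (\<Sum>j\<in>{1..<n}. q ^ j)"
  proof (intro sum_mono card_power_fixed_le)
    fix j assume "j \<in> {1..<n}"
    then have "q ^ 1 \<le> q ^ j" using q_ge_2 by (intro power_increasing) auto
    then show "q ^ j \<ge> 2" using q_ge_2 by simp
  qed
  also have "\<dots> < q ^ n"
  proof -
    have "(\<Sum>j<m. q ^ j) < q ^ m" for m
    proof (induction m)
      case (Suc m)
      have "(\<Sum>j<Suc m. q ^ j) < 2 * q ^ m" using Suc by simp
      also have "\<dots> \<le> q * q ^ m" using q_ge_2 by (intro mult_right_mono) auto
      finally show ?case by simp
    qed simp
    moreover have "(\<Sum>j\<in>{1..<n}. q ^ j) \<le> (\<Sum>j<n. q ^ j)"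
      by (intro sum_mono2) auto
    ultimately show ?thesis by (meson le_less_trans)
  qed
  finally show False using card_field by simp
qed

text \<open>
  For \<open>e j = g ^ j\<close> with distinct conjugates of \<open>g\<close>, the matrix of all \<open>\<sigma>\<^sup>k (e j)\<close> is a
  Vandermonde matrix.
\<close>

lemma ex_moore_inverse:
  obtains e :: "nat \<Rightarrow> 'a" and E :: "nat \<Rightarrow> nat \<Rightarrow> 'a" where
    "\<And>j l. j < n \<Longrightarrow> l < n \<Longrightarrow> (\<Sum>k<n. E j k * (\<sigma> ^^ k) (e l)) = (if j = l then 1 else 0)"
    "\<And>k l. k < n \<Longrightarrow> l < n \<Longrightarrow> (\<Sum>j<n. (\<sigma> ^^ k) (e j) * E j l) = (if k = l then 1 else 0)"
proof -
  obtain g where g: "inj_on (\<lambda>k. (\<sigma> ^^ k) g) {..<n}" using ex_inj_conjugates by blast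
  let ?M = "mat n n (\<lambda>(k, j). (\<sigma> ^^ k) g ^ j)"
  have conj: "(\<sigma> ^^ k) (g ^ j) = (\<sigma> ^^ k) g ^ j" for k j
    by (simp add: funpow_frob frob_def mult.commute flip: power_mult)
  have "?M \<in> Units (ring_mat TYPE('a) n ())"
    using det_vandermonde_nonzero[OF g] by (intro det_non_zero_imp_unit) auto
  then obtain B where B: "B \<in> carrier_mat n n" "B * ?M = 1\<^sub>m n" "?M * B = 1\<^sub>m n"
    unfolding Units_def ring_mat_def by auto
  show ?thesis
  proof (rule that[of "\<lambda>j k. B $$ (j, k)" "\<lambda>j. g ^ j"])
    fix j l assume jl: "j < n" "l < n"
    have "(B * ?M) $$ (j, l) = (\<Sum>k<n. B $$ (j, k) * (\<sigma> ^^ k) (g ^ l))"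
      using jl B(1) by (simp add: scalar_prod_def atLeast0LessThan conj)
    then show "(\<Sum>k<n. B $$ (j, k) * (\<sigma> ^^ k) (g ^ l)) = (if j = l then 1 else 0)"
      using jl B(2) by simp
    have "(?M * B) $$ (j, l) = (\<Sum>k<n. (\<sigma> ^^ j) (g ^ k) * B $$ (k, l))"
      using jl B(1) by (simp add: scalar_prod_def atLeast0LessThan conj)
    then show "(\<Sum>k<n. (\<sigma> ^^ j) (g ^ k) * B $$ (k, l)) = (if j = l then 1 else 0)"
      using jl B(3) by simp
  qed
qed

text \<open>
  Instead of a basis of the fixed space, this compares \<open>n\<close>-tuples of fixed points with fixed points
  of \<open>\<Psi>\<^sup>n\<close>, by \<open>f \<mapsto> \<Sum>\<^sub>j e j * f j\<close> and \<open>w \<mapsto> (\<Sum>\<^sub>k \<Psi>\<^sup>k (e j * w))\<^sub>j\<close>.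
\<close>

lemma card_fixed_points_semilinear:
  fixes scale :: "'a \<Rightarrow> 'b :: ab_group_add \<Rightarrow> 'b"
  assumes "vector_space scale"
    and add: "\<And>x y. \<Psi> (x + y) = \<Psi> x + \<Psi> y"
    and scale: "\<And>c x. \<Psi> (scale c x) = scale (\<sigma> c) (\<Psi> x)"
    and fin: "finite {x. (\<Psi> ^^ n) x = x}"
  shows "card {x. (\<Psi> ^^ n) x = x} = card {x. \<Psi> x = x} ^ n"
proof -
  interpret vector_space scale by fact
  obtain e E where
    EM: "\<And>j l. j < n \<Longrightarrow> l < n \<Longrightarrow> (\<Sum>k<n. E j k * (\<sigma> ^^ k) (e l)) = (if j = l then 1 else 0)" and
    ME: "\<And>k l. k < n \<Longrightarrow> l < n \<Longrightarrow> (\<Sum>j<n. (\<sigma> ^^ k) (e j) * E j l) = (if k = l then 1 else 0)"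
    by (rule ex_moore_inverse) blast
  let ?W = "{x. (\<Psi> ^^ n) x = x}" and ?F = "{x. \<Psi> x = x}"
  have zero: "\<Psi> 0 = 0" using add[of 0 0] by simp
  have sum1: "\<Psi> (\<Sum>i\<in>I. f i) = (\<Sum>i\<in>I. \<Psi> (f i))" for f :: "nat \<Rightarrow> 'b" and I
    by (induction I rule: infinite_finite_induct) (auto simp: add zero)
  have sumk: "(\<Psi> ^^ k) (\<Sum>i\<in>I. f i) = (\<Sum>i\<in>I. (\<Psi> ^^ k) (f i))" for f :: "nat \<Rightarrow> 'b" and I k
    by (induction k) (auto simp: sum1)
  have scalek: "(\<Psi> ^^ k) (scale c x) = scale ((\<sigma> ^^ k) c) ((\<Psi> ^^ k) x)" for k c x
    by (induction k) (auto simp: scale)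
  have fixk: "(\<Psi> ^^ k) x = x" if "\<Psi> x = x" for k x
    using that by (induction k) auto
  have FW: "?F \<subseteq> ?W" using fixk by auto
  then have finF: "finite ?F" using fin finite_subset by blast
  have finP: "finite ({..<n} \<rightarrow>\<^sub>E ?F)" using finF by (intro finite_PiE) auto
  have cardP: "card ({..<n} \<rightarrow>\<^sub>E ?F) = card ?F ^ n" by (simp add: card_PiE)
  define T where "T w = (\<lambda>j\<in>{..<n}. \<Sum>k<n. (\<Psi> ^^ k) (scale (e j) w))" for w
  have T_mem: "T w \<in> {..<n} \<rightarrow>\<^sub>E ?F" if "w \<in> ?W" for w
  proof -
    \<comment> \<open>\<open>\<Psi>\<close> shifts the orbit sum by one place, and the entering term
      \<open>\<Psi>^n v\<close> equals the leaving term \<open>v\<close>.\<close>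
    have "\<Psi> (\<Sum>k<n. (\<Psi> ^^ k) v) = (\<Sum>k<n. (\<Psi> ^^ k) v)" if v: "(\<Psi> ^^ n) v = v" for v
    proof -
      have "v + \<Psi> (\<Sum>k<n. (\<Psi> ^^ k) v) = (\<Sum>k<Suc n. (\<Psi> ^^ k) v)"
        by (simp add: sum1 sum.lessThan_Suc_shift del: sum.lessThan_Suc)
      also have "\<dots> = v + (\<Sum>k<n. (\<Psi> ^^ k) v)" by (simp add: v)
      finally show ?thesis by simp
    qed
    from this[of "scale (e j) w" for j] show ?thesis
      using that by (auto simp: T_def scalek funpow_frob)
  qed
  \<comment> \<open>Column 0 of \<open>E\<close> extracts the term \<open>k = 0\<close>, which is
    \<open>w\<close> itself.\<close>
  have T_inv: "(\<Sum>j<n. scale (E j 0) (T w j)) = w" for w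
  proof -
    have "(\<Sum>j<n. scale (E j 0) (T w j)) = (\<Sum>j<n. \<Sum>k<n. scale ((\<sigma> ^^ k) (e j) * E j 0) ((\<Psi> ^^ k) w))"
      by (simp add: T_def scalek scale_sum_right mult.commute)
    also have "\<dots> = (\<Sum>k<n. scale (\<Sum>j<n. (\<sigma> ^^ k) (e j) * E j 0) ((\<Psi> ^^ k) w))"
      by (subst sum.swap) (simp add: scale_sum_left)
    also have "\<dots> = (\<Sum>k<n. if k = 0 then (\<Psi> ^^ k) w else 0)"
      using n by (intro sum.cong) (auto simp: ME)
    also have "\<dots> = w" using n by (simp add: sum.delta)
    finally show ?thesis .
  qed
  define S where "S f = (\<Sum>j<n. scale (e j) (f j))" for f
  have Sk: "(\<Psi> ^^ k) (S f) = (\<Sum>j<n. scale ((\<sigma> ^^ k) (e j)) (f j))" if "f \<in> {..<n} \<rightarrow>\<^sub>E ?F" for f k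
    using that by (auto simp: S_def sumk scalek fixk PiE_def Pi_def)
  \<comment> \<open>The iterates of \<open>S f\<close> form a Moore system for the entries of
    \<open>f\<close>; row \<open>l\<close> of \<open>E\<close> solves it for
    \<open>f l\<close>.\<close>
  have S_inv: "(\<Sum>k<n. scale (E l k) ((\<Psi> ^^ k) (S f))) = f l" if f: "f \<in> {..<n} \<rightarrow>\<^sub>E ?F" and l: "l < n" for f l
  proof -
    have "(\<Sum>k<n. scale (E l k) ((\<Psi> ^^ k) (S f))) = (\<Sum>k<n. \<Sum>j<n. scale (E l k * (\<sigma> ^^ k) (e j)) (f j))"
      by (simp add: Sk[OF f] scale_sum_right)
    also have "\<dots> = (\<Sum>j<n. scale (\<Sum>k<n. E l k * (\<sigma> ^^ k) (e j)) (f j))"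
      by (subst sum.swap) (simp add: scale_sum_left)
    also have "\<dots> = (\<Sum>j<n. if l = j then f j else 0)"
      using l by (intro sum.cong) (auto simp: EM)
    also have "\<dots> = f l" using l by (simp add: sum.delta)
    finally show ?thesis .
  qed
  \<comment> \<open>\<open>T\<close> and \<open>S\<close> each have a left inverse, so injections in
    both directions give the equality.\<close>
  have "card ?W \<le> card ({..<n} \<rightarrow>\<^sub>E ?F)"
  proof (rule card_inj_on_le[OF _ _ finP])
    show "inj_on T ?W" by (rule inj_on_inverseI[of _ "\<lambda>f. \<Sum>j<n. scale (E j 0) (f j)"]) (simp add: T_inv)
    show "T ` ?W \<subseteq> {..<n} \<rightarrow>\<^sub>E ?F" using T_mem by blast
  qed
  moreover have "card ({..<n} \<rightarrow>\<^sub>E ?F) \<le> card ?W"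
  proof (rule card_inj_on_le[OF _ _ fin])
    show "inj_on S ({..<n} \<rightarrow>\<^sub>E ?F)"
    proof (rule inj_on_inverseI)
      fix f assume f: "f \<in> {..<n} \<rightarrow>\<^sub>E ?F"
      then show "(\<lambda>l\<in>{..<n}. \<Sum>k<n. scale (E l k) ((\<Psi> ^^ k) (S f))) = f"
        by (intro extensionalityI[of _ "{..<n}"]) (simp_all add: S_inv PiE_def)
    qed
    have "(\<Psi> ^^ n) (S f) = S f" if "f \<in> {..<n} \<rightarrow>\<^sub>E ?F" for f
      using Sk[OF that, of n] by (simp add: S_def funpow_frob)
    then show "S ` ({..<n} \<rightarrow>\<^sub>E ?F) \<subseteq> ?W" by blast
  qed
  ultimately show ?thesis using cardP by simp
qed

section \<open>Norms and projective roots\<close>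

text \<open>\<open>br y i\<close> is the paper's bracket power of \<open>y\<close>; for \<open>i = n\<close> it is the norm to the fixed field.\<close>

definition br :: "'a \<Rightarrow> nat \<Rightarrow> 'a" where
  "br y i = (\<Prod>j<i. frob q (s * j) y)"

abbreviation norm_n :: "'a \<Rightarrow> 'a" where "norm_n y \<equiv> br y n"

lemma br_0 [simp]: "br y 0 = 1"
  by (simp add: br_def)

lemma br_Suc: "br y (Suc i) = y * \<sigma> (br y i)"
  unfolding br_def prod.lessThan_Suc_shift frob_prod by (simp add: frob_frob frob_def[of q 0])

lemma br_Suc': "br y (Suc i) = br y i * frob q (s * i) y"
  by (simp add: br_def)

lemma br_eq_0_iff: "br y i = 0 \<longleftrightarrow> y = 0 \<and> i > 0"
  by (induction i) (auto simp: br_Suc)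

lemma norm_eq_0_iff [simp]: "norm_n y = 0 \<longleftrightarrow> y = 0"
  using n by (simp add: br_eq_0_iff)

lemma br_1 [simp]: "br 1 i = 1"
  by (simp add: br_def)

lemma br_mult: "br (x * y) i = br x i * br y i"
  by (simp add: br_def frob_mult prod.distrib)

lemma br_divide: "br (x / y) i = br x i / br y i"
  by (simp add: br_def frob_divide prod_dividef)

text \<open>The product telescopes. For \<open>i = n\<close> this is the easy direction of Hilbert
  90: \<open>\<sigma> x / x\<close> has norm 1.\<close>

lemma br_coboundary: "br (\<sigma> x / x) i * x = frob q (s * i) x" if "x \<noteq> 0"
proof (induction i)
  case (Suc i)
  have "br (\<sigma> x / x) (Suc i) * x = (br (\<sigma> x / x) i * x) * (frob q (s * i + s) x / frob q (s * i) x)"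
    by (simp add: br_Suc' frob_divide frob_frob)
  then show ?case using that by (simp add: Suc add.commute)
qed (simp add: frob_def)

text \<open>Splitting off the first or the last factor of \<open>br y (n + 1)\<close> gives
  \<open>y * \<sigma> (norm_n y) = norm_n y * y\<close>, because \<open>\<sigma>^n\<close> is the
  identity.\<close>

lemma frob_norm: "\<sigma> (norm_n y) = norm_n y"
proof (cases "y = 0")
  case False
  have "y * \<sigma> (norm_n y) = y * norm_n y"
    using br_Suc[of y n] br_Suc'[of y n] frob_multiple_n[of s y]
    by (simp only: mult.commute[of _ y])
  with False show ?thesis by simp
qed (use n in \<open>simp add: br_def zero_power\<close>)

section \<open>Hilbert 90 by counting: fibres and image of the norm\<close>

lemma vector_space_self: "vector_space ((*) :: 'a \<Rightarrow> 'a \<Rightarrow> 'a)"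
  by standard (auto simp: algebra_simps)

text \<open>The \<open>n\<close>-th iterate of the semilinear map
  \<open>x \<mapsto> y * \<sigma> x\<close> is multiplication by the norm of \<open>y\<close>, here
  the identity on \<open>q ^ n\<close> elements; descent takes the \<open>n\<close>-th root. The
  case \<open>y = 1\<close> counts the fixed field.\<close>

lemma card_twisted_fixed:
  assumes "norm_n y = 1"
  shows "card {x. y * \<sigma> x = x} = q"
proof -
  have iter: "((\<lambda>x. y * \<sigma> x) ^^ k) x = br y k * frob q (s * k) x" for k x
    by (induction k) (auto simp: br_Suc frob_mult frob_frob frob_def[of q 0])
  have "card {x. ((\<lambda>x. y * \<sigma> x) ^^ n) x = x} = card {x. y * \<sigma> x = x} ^ n"
    by (rule card_fixed_points_semilinear[OF vector_space_self])
      (auto simp: frob_add frob_mult algebra_simps)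
  then have "q ^ n = card {x. y * \<sigma> x = x} ^ n"
    by (simp add: iter assms card_field)
  then show ?thesis using n by (metis power_eq_iff_eq_base zero_le less_eq_Suc_le One_nat_def)
qed

text \<open>Elements of \<open>F\<close> satisfy \<open>x ^ q = x\<close> and so are fixed by
  \<open>\<sigma>\<close>; both sets have \<open>q\<close> elements.\<close>

lemma fixed_field:
  assumes "subfield F (class_ring :: 'a ring)" "card F = q"
  shows "F = {x. \<sigma> x = x}"
proof (rule card_subset_eq)
  have "x ^ (q ^ t) = x" if "x \<in> F" for x t
    by (induction t) (use subfield_power_card[OF assms(1) that] assms(2) in \<open>auto simp: power_mult\<close>)
  then show "F \<subseteq> {x. \<sigma> x = x}" by (auto simp: frob_def)
  show "card F = card {x. \<sigma> x = x}" using card_twisted_fixed[of 1] assms by simp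
qed simp

text \<open>Pairs \<open>(y, t)\<close> with \<open>t \<noteq> 0\<close> and
  \<open>y * \<sigma> t = c * t\<close> are counted twice: \<open>t\<close> determines
  \<open>y\<close>, which then has the norm of \<open>c\<close>, while each \<open>y\<close> in the
  fibre admits \<open>q - 1\<close> values of \<open>t\<close>.\<close>

lemma card_norm_fibre:
  assumes "c \<noteq> 0"
  shows "card {y. norm_n y = norm_n c} * (q - 1) = q ^ n - 1"
proof -
  let ?Y = "{y. norm_n y = norm_n c}"
  let ?X = "\<lambda>y. {t. t \<noteq> 0 \<and> y * \<sigma> t = c * t}"
  have "card (?X y) = q - 1" if "y \<in> ?Y" for y
  proof -
    have "norm_n (y / c) = 1"
      using that assms by (simp add: br_divide br_eq_0_iff)
    then have "card {t. y / c * \<sigma> t = t} = q" by (rule card_twisted_fixed)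
    moreover have "?X y = {t. y / c * \<sigma> t = t} - {0}"
      using assms by (auto simp: field_simps)
    ultimately show ?thesis by (simp add: card_Diff_singleton)
  qed
  then have "card ?Y * (q - 1) = (\<Sum>y\<in>?Y. card (?X y))" by simp
  also have "\<dots> = card (Sigma ?Y ?X)" by simp
  also have "\<dots> = card (UNIV - {0 :: 'a})"
  proof (rule bij_betw_same_card[of snd], rule bij_betw_byWitness[where f' = "\<lambda>t. (c * t / \<sigma> t, t)"])
    have "norm_n (c * t / \<sigma> t) = norm_n c" if "t \<noteq> 0" for t
    proof -
      have "norm_n (\<sigma> t / t) = 1" using br_coboundary[OF that, of n] that by simp
      then have "norm_n (c / (\<sigma> t / t)) = norm_n c" by (subst br_divide) simp
      then show ?thesis by simp
    qed
    then show "(\<lambda>t. (c * t / \<sigma> t, t)) ` (UNIV - {0}) \<subseteq> Sigma ?Y ?X" by auto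
  qed (auto simp: field_simps)
  also have "\<dots> = q ^ n - 1" by (simp add: card_Diff_singleton card_field)
  finally show ?thesis .
qed

lemma q_pow_n_gt_1: "q ^ n > 1"
  using q_ge_2 n by (intro one_less_power) auto

text \<open>All fibres over the image have \<open>(q^n - 1) / (q - 1)\<close> elements, so the image
  has \<open>q - 1\<close>, as many as there are nonzero fixed elements.\<close>

lemma norm_image: "norm_n ` (UNIV - {0}) = {x. \<sigma> x = x} - {0}"
proof (rule card_subset_eq)
  let ?I = "norm_n ` (UNIV - {0})"
  show "?I \<subseteq> {x. \<sigma> x = x} - {0}"
    by (auto simp: frob_norm br_eq_0_iff)
  have "card (UNIV - {0 :: 'a}) = (\<Sum>l\<in>?I. card {y \<in> UNIV - {0}. norm_n y = l})"
    using sum.image_gen[of "UNIV - {0 :: 'a}" "\<lambda>_. 1 :: nat" norm_n] by simp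
  also have "\<dots> = (\<Sum>l\<in>?I. card {y. norm_n y = l})"
  proof (rule sum.cong)
    fix l assume "l \<in> ?I"
    then have "{y \<in> UNIV - {0}. norm_n y = l} = {y. norm_n y = l}"
      by auto (metis norm_eq_0_iff)
    then show "card {y \<in> UNIV - {0}. norm_n y = l} = card {y. norm_n y = l}" by simp
  qed simp
  finally have "(q ^ n - 1) * (q - 1) = (\<Sum>l\<in>?I. card {y. norm_n y = l} * (q - 1))"
    by (simp add: card_Diff_singleton card_field sum_distrib_right)
  also have "\<dots> = (\<Sum>l\<in>?I. q ^ n - 1)"
    by (intro sum.cong refl) (use card_norm_fibre in blast)
  finally have "card ?I = q - 1" using q_pow_n_gt_1 by simp
  then show "card ?I = card ({x. \<sigma> x = x} - {0})"
    using card_twisted_fixed[of 1] by (simp add: card_Diff_singleton)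
qed simp

text \<open>The double count of pairs \<open>(y, x)\<close> is kept free of matrices:
  \<open>m\<close> gives the number of roots as a function of the norm, and becomes
  \<open>q ^ eigenspace_dim\<close> in the application.\<close>

lemma card_proj_roots:
  assumes "a 0 \<noteq> 0"
    and card: "\<And>y. y \<noteq> 0 \<Longrightarrow> card {x. (\<Sum>i\<le>d. a i * br y i * frob q (s * i) x) = 0} = m (norm_n y)"
  shows "card {y. (\<Sum>i\<le>d. a i * br y i) = 0} * (q - 1) = (\<Sum>l\<in>{x. \<sigma> x = x} - {0}. m l - 1)"
proof -
  let ?Z = "\<lambda>y. {x. (\<Sum>i\<le>d. a i * br y i * frob q (s * i) x) = 0}"
  let ?R = "{y. (\<Sum>i\<le>d. a i * br y i) = 0}"
  let ?U = "UNIV - {0 :: 'a}"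
  \<comment> \<open>Projective roots must be nonzero for the inverse map
    \<open>(x, r) \<mapsto> r * x / \<sigma> x\<close> to land in nonzero \<open>y\<close>.\<close>
  have "(\<Sum>i\<le>d. a i * br 0 i) = a 0"
    by (subst sum.remove[of _ 0]) (auto intro!: sum.neutral simp: br_eq_0_iff)
  then have R0: "0 \<notin> ?R" using assms(1) by simp
  \<comment> \<open>The telescoping identity absorbs \<open>\<sigma>^i x\<close> into the bracket
    power, at the cost of a factor \<open>x\<close>.\<close>
  have key: "(\<Sum>i\<le>d. a i * br y i * frob q (s * i) x) = x * (\<Sum>i\<le>d. a i * br (y * \<sigma> x / x) i)"
    if "x \<noteq> 0" for x y
  proof -
    have "a i * br y i * frob q (s * i) x = x * (a i * br (y * \<sigma> x / x) i)" for i
      using br_coboundary[OF that, of i] br_mult[of y "\<sigma> x / x" i]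
      by (simp add: mult_ac flip: times_divide_eq_right)
    then show ?thesis unfolding sum_distrib_left by (rule sum.cong[OF refl])
  qed
  have "card (Sigma ?U (\<lambda>y. ?Z y - {0})) = card (?U \<times> ?R)"
  proof (rule bij_betw_same_card[of "\<lambda>(y, x). (x, y * \<sigma> x / x)"],
      rule bij_betw_byWitness[where f' = "\<lambda>(x, r). (r * x / \<sigma> x, x)"])
    show "(\<lambda>(y, x). (x, y * \<sigma> x / x)) ` Sigma ?U (\<lambda>y. ?Z y - {0}) \<subseteq> ?U \<times> ?R"
      using key by auto
    show "(\<lambda>(x, r). (r * x / \<sigma> x, x)) ` (?U \<times> ?R) \<subseteq> Sigma ?U (\<lambda>y. ?Z y - {0})"
      using R0 by (auto simp: key)
  qed auto
  then have "(q ^ n - 1) * card ?R = (\<Sum>y\<in>?U. card (?Z y - {0}))"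
    by (simp add: card_cartesian_product card_Diff_singleton card_field)
  also have "\<dots> = (\<Sum>y\<in>?U. m (norm_n y) - 1)"
    by (intro sum.cong) (auto simp: card_Diff_singleton card)
  also have "\<dots> = (\<Sum>l\<in>norm_n ` ?U. \<Sum>y\<in>{y \<in> ?U. norm_n y = l}. m (norm_n y) - 1)"
    by (rule sum.image_gen) simp
  also have "\<dots> = (\<Sum>l\<in>norm_n ` ?U. card {y. norm_n y = l} * (m l - 1))"
  proof (rule sum.cong)
    fix l assume "l \<in> norm_n ` ?U"
    then have "{y \<in> ?U. norm_n y = l} = {y. norm_n y = l}"
      by auto (metis norm_eq_0_iff)
    then show "(\<Sum>y\<in>{y \<in> ?U. norm_n y = l}. m (norm_n y) - 1) = card {y. norm_n y = l} * (m l - 1)"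
      by simp
  qed simp
  \<comment> \<open>The factor \<open>q - 1\<close> completes every fibre size to
    \<open>q ^ n - 1\<close>, which then cancels on both sides.\<close>
  finally have "(q ^ n - 1) * card ?R * (q - 1) = (\<Sum>l\<in>norm_n ` ?U. card {y. norm_n y = l} * (m l - 1)) * (q - 1)"
    by simp
  also have "\<dots> = (\<Sum>l\<in>norm_n ` ?U. (card {y. norm_n y = l} * (q - 1)) * (m l - 1))"
    unfolding sum_distrib_right by (intro sum.cong refl) (simp only: mult_ac)
  also have "\<dots> = (\<Sum>l\<in>norm_n ` ?U. (q ^ n - 1) * (m l - 1))"
  proof (intro sum.cong refl arg_cong2[where f = "(*)"])
    fix l assume "l \<in> norm_n ` ?U"
    then show "card {y. norm_n y = l} * (q - 1) = q ^ n - 1"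
      using card_norm_fibre by blast
  qed
  also have "\<dots> = (q ^ n - 1) * (\<Sum>l\<in>{x. \<sigma> x = x} - {0}. m l - 1)"
    by (simp only: norm_image sum_distrib_left)
  finally show ?thesis using q_pow_n_gt_1 by (simp add: mult.assoc)
qed

section \<open>The semilinear map of the companion matrix\<close>

text \<open>Transposed partial products of \<open>A_mat\<close>. Transposition puts each new factor
  on the left, in the order in which the semilinear map is iterated.\<close>

primrec tprod :: "nat \<Rightarrow> (nat \<Rightarrow> 'a) \<Rightarrow> nat \<Rightarrow> 'a mat" where
  "tprod d a 0 = 1\<^sub>m d"
| "tprod d a (Suc k) = map_mat (frob q (s * k)) (transpose_mat (companion d a)) * tprod d a k"

lemma companion_carrier [simp]: "companion d a \<in> carrier_mat d d"
  by (simp add: companion_def)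

lemma tprod_carrier [simp]: "tprod d a k \<in> carrier_mat d d"
  by (induction k) (auto intro!: mult_carrier_mat[of _ d d])

lemma transpose_A_mat: "transpose_mat (A_mat q n s d a) = tprod d a n" "A_mat q n s d a \<in> carrier_mat d d"
proof -
  let ?g = "\<lambda>i. map_mat (\<sigma> ^^ i) (companion d a)"
  let ?P = "\<lambda>k. foldr (*) (map ?g [0..<k]) (1\<^sub>m d)"
  have P: "?P k \<in> carrier_mat d d" for k
  proof -
    have "?P k = ?P k * 1\<^sub>m d \<and> ?P k \<in> carrier_mat d d"
      by (rule foldr_mult_mat) auto
    then show ?thesis by (rule conjunct2)
  qed
  \<comment> \<open>The fold starts from the first factor, whereas \<open>tprod\<close> grows by the
    last one.\<close>
  have step: "?P (Suc k) = ?P k * ?g k" for k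
  proof -
    have "foldr (*) (map ?g [0..<k]) (?g k) = ?P k * ?g k \<and> ?P k \<in> carrier_mat d d"
      by (rule foldr_mult_mat) auto
    moreover have "?P (Suc k) = foldr (*) (map ?g [0..<k]) (?g k * 1\<^sub>m d)" by simp
    moreover have "?g k * 1\<^sub>m d = ?g k" by (rule right_mult_one_mat[of _ d d]) simp
    ultimately show ?thesis by (simp only:)
  qed
  have "transpose_mat (?P k) = tprod d a k" for k
  proof (induction k)
    case (Suc k)
    have "transpose_mat (?P (Suc k)) = transpose_mat (?g k) * transpose_mat (?P k)"
      unfolding step by (rule transpose_mult[OF P, of _ d]) simp
    moreover have "transpose_mat (?g k) = map_mat (frob q (s * k)) (transpose_mat (companion d a))"
      by (intro eq_matI) (auto simp: funpow_frob)
    ultimately show ?case by (simp only: Suc tprod.simps)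
  qed (simp add: transpose_one)
  then show "transpose_mat (A_mat q n s d a) = tprod d a n" "A_mat q n s d a \<in> carrier_mat d d"
    using P by (simp_all add: A_mat_def)
qed


section \<open>Iterates of the semilinear map and eigenvectors\<close>

lemma mult_mat_vec_index:
  assumes "M \<in> carrier_mat d d" "v \<in> carrier_vec d" "i < d"
  shows "(M *\<^sub>v v) $ i = (\<Sum>j<d. M $$ (i, j) * (v $ j :: 'a))"
  using assms by (simp add: scalar_prod_def atLeast0LessThan)

text \<open>Congruent to \<open>-s\<close> modulo \<open>n\<close>, so \<open>frob q s_inv\<close>
  is the inverse of \<open>\<sigma>\<close> with a natural exponent.\<close>

definition s_inv :: nat where "s_inv = s * (n - 1)"

text \<open>
  Row vectors are functions vanishing from \<open>d\<close> on, because the descent lemma needs an additive type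
  class, which \<open>vec\<close> lacks.
\<close>

definition comp_map :: "nat \<Rightarrow> (nat \<Rightarrow> 'a) \<Rightarrow> 'a \<Rightarrow> (nat \<Rightarrow> 'a) \<Rightarrow> nat \<Rightarrow> 'a" where
  "comp_map d a y f = (\<lambda>i.
    if i < d then frob q (s_inv) ((transpose_mat (companion d a) *\<^sub>v vec d f) $ i / y) else 0)"

lemma frob_cancel [simp]:
  "frob q (s_inv * k) (frob q (s * k) x) = (x :: 'a)"
  "frob q (s * k) (frob q (s_inv * k) x) = (x :: 'a)"
proof -
  have "s_inv * k + s * k = s * k * n"
    using n unfolding s_inv_def by (cases n) (auto simp: algebra_simps)
  then show "frob q (s_inv * k) (frob q (s * k) x) = x"
    "frob q (s * k) (frob q (s_inv * k) x) = x"
    by (simp_all only: frob_frob frob_multiple_n add.commute)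
qed

text \<open>Moving the \<open>k\<close> inverse Frobenius maps past the next matrix applies
  \<open>\<sigma>^k\<close> to its entries, and the divisors collect into \<open>br y k\<close>. The
  support condition serves \<open>k = 0\<close>, where the right side is cut off at
  \<open>d\<close>.\<close>

lemma comp_map_funpow:
  assumes supp: "\<And>i. i \<ge> d \<Longrightarrow> f i = 0"
  shows "(comp_map d a y ^^ k) f =
    (\<lambda>i. if i < d then frob q (s_inv * k) ((tprod d a k *\<^sub>v vec d f) $ i / br y k) else 0)"
proof (induction k)
  case 0
  then show ?case using supp by (auto simp: fun_eq_iff frob_def)
next
  case (Suc k)
  let ?M = "transpose_mat (companion d a)" and ?t = "s_inv"
  define w where "w = tprod d a k *\<^sub>v vec d f"
  have w: "w \<in> carrier_vec d" unfolding w_def by (rule mult_mat_vec_carrier[of _ d d]) auto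
  define g where "g = (comp_map d a y ^^ k) f"
  have g: "g i = frob q (?t * k) (w $ i / br y k)" if "i < d" for i
    using that Suc by (simp add: g_def w_def)
  have "frob q ?t ((?M *\<^sub>v vec d g) $ i / y) =
      frob q (?t * Suc k) ((tprod d a (Suc k) *\<^sub>v vec d f) $ i / br y (Suc k))" if i: "i < d" for i
  proof -
    have "(?M *\<^sub>v vec d g) $ i = (\<Sum>j<d. ?M $$ (i, j) * g j)"
      using i by (subst mult_mat_vec_index[of _ d]) auto
    also have "\<dots> = (\<Sum>j<d. frob q (?t * k) (frob q (s * k) (?M $$ (i, j)) * w $ j / br y k))"
      by (intro sum.cong) (auto simp: g frob_mult frob_divide)
    also have "\<dots> = frob q (?t * k) ((\<Sum>j<d. frob q (s * k) (?M $$ (i, j)) * w $ j) / br y k)"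
      by (simp add: sum_divide_distrib frob_sum)
    also have "(\<Sum>j<d. frob q (s * k) (?M $$ (i, j)) * w $ j) = (map_mat (frob q (s * k)) ?M *\<^sub>v w) $ i"
      using i w by (subst mult_mat_vec_index[of _ d]) (auto simp: companion_def)
    also have "map_mat (frob q (s * k)) ?M *\<^sub>v w = tprod d a (Suc k) *\<^sub>v vec d f"
      unfolding w_def tprod.simps by (rule assoc_mult_mat_vec[symmetric, of _ d d _ d]) auto
    finally have *: "(?M *\<^sub>v vec d g) $ i
      = frob q (?t * k) ((tprod d a (Suc k) *\<^sub>v vec d f) $ i / br y k)" .
    \<comment> \<open>In this form the new divisor joins \<open>br y k\<close> under the common
      Frobenius map.\<close>
    have "y = frob q (?t * k) (frob q (s * k) y)" by simp
    then have "(?M *\<^sub>v vec d g) $ i / y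
      = frob q (?t * k) ((tprod d a (Suc k) *\<^sub>v vec d f) $ i / br y (Suc k))"
      unfolding * br_Suc' by (metis frob_divide divide_divide_eq_left)
    then show ?thesis by (simp add: frob_frob)
  qed
  then have "comp_map d a y g = (\<lambda>i. if i < d then
      frob q (?t * Suc k) ((tprod d a (Suc k) *\<^sub>v vec d f) $ i / br y (Suc k)) else 0)"
    unfolding comp_map_def fun_eq_iff by simp
  then show ?case by (simp add: g_def)
qed

text \<open>After \<open>n\<close> steps the outer Frobenius is the identity, so being fixed means
  being an eigenvector of \<open>tprod d a n\<close> for the norm of \<open>y\<close>; the transpose
  count then passes to \<open>A_mat\<close>.\<close>

lemma card_fixed_comp_map_funpow:
  assumes "y \<noteq> 0"
  shows "card {f. (comp_map d a y ^^ n) f = f} = card (eigenspace (A_mat q n s d a) (norm_n y))"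
    and "finite {f. (comp_map d a y ^^ n) f = f}"
proof -
  let ?W = "{f. (comp_map d a y ^^ n) f = f}" and ?E = "eigenspace (tprod d a n) (norm_n y)"
  \<comment> \<open>Since \<open>n \<ge> 1\<close>, a fixed point is a value of
    \<open>comp_map\<close>, and these vanish from \<open>d\<close> on.\<close>
  have supp: "f i = 0" if "f \<in> ?W" "i \<ge> d" for f i
  proof -
    obtain m where m: "n = Suc m" using n by (cases n) auto
    have "comp_map d a y ((comp_map d a y ^^ m) f) = f"
      using that(1) unfolding m by simp
    from fun_cong[OF this, of i] show ?thesis using that(2) by (simp add: comp_map_def)
  qed
  have iff: "(comp_map d a y ^^ n) f = f \<longleftrightarrow> tprod d a n *\<^sub>v vec d f = norm_n y \<cdot>\<^sub>v vec d f"
    if "\<And>i. i \<ge> d \<Longrightarrow> f i = 0" for f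
  proof -
    have "(comp_map d a y ^^ n) f = f \<longleftrightarrow> (\<forall>i<d. (tprod d a n *\<^sub>v vec d f) $ i / norm_n y = f i)"
      by (subst comp_map_funpow) (auto simp: fun_eq_iff that)
    also have "\<dots> \<longleftrightarrow> tprod d a n *\<^sub>v vec d f = norm_n y \<cdot>\<^sub>v vec d f"
      using assms carrier_matD(1)[OF tprod_carrier[of d a n]] by (auto simp: vec_eq_iff field_simps)
    finally show ?thesis .
  qed
  have bij: "bij_betw (vec d) ?W ?E"
  proof (rule bij_betw_byWitness[where f' = "\<lambda>u i. if i < d then u $ i else 0"])
    have dim: "dim_row (tprod d a n) = d" using tprod_carrier[of d a n] by (rule carrier_matD)
    show "\<forall>f\<in>?W. (\<lambda>i. if i < d then vec d f $ i else 0) = f"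
      using supp by (auto simp: fun_eq_iff)
    show "\<forall>u\<in>?E. vec d (\<lambda>i. if i < d then u $ i else 0) = u"
      by (auto simp: eigenspace_def dim)
    show "vec d ` ?W \<subseteq> ?E"
    proof
      fix u assume "u \<in> vec d ` ?W"
      then obtain f where f: "u = vec d f" "f \<in> ?W" by blast
      with iff[of f] supp[of f] show "u \<in> ?E" by (simp add: eigenspace_def dim)
    qed
    show "(\<lambda>u i. if i < d then u $ i else 0) ` ?E \<subseteq> ?W"
    proof
      fix f assume "f \<in> (\<lambda>u i. if i < d then u $ i else 0) ` ?E"
      then obtain u where u: "u \<in> ?E" "f = (\<lambda>i. if i < d then u $ i else 0)" by blast
      have "vec d f = u" using u by (auto simp: eigenspace_def dim)
      moreover have "\<And>i. i \<ge> d \<Longrightarrow> f i = 0" using u by simp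
      ultimately show "f \<in> ?W" using u iff[of f] by (simp add: eigenspace_def)
    qed
  qed
  have "finite ?E"
    by (rule finite_subset[OF _ finite_carrier_vec[of "dim_row (tprod d a n)"]]) (auto simp: eigenspace_def)
  with bij show "finite ?W" by (simp add: bij_betw_finite)
  have "card ?W = card ?E" using bij by (rule bij_betw_same_card)
  then show "card ?W = card (eigenspace (A_mat q n s d a) (norm_n y))"
    using card_eigenspace_transpose[OF transpose_A_mat(2)] by (simp add: transpose_A_mat(1))
qed

section \<open>Fixed points of the semilinear map and roots of the twisted linear equation\<close>

lemma companion_transpose_mult_index:
  fixes a :: "nat \<Rightarrow> 'a"
  assumes "i < d"
  shows "(transpose_mat (companion d a) *\<^sub>v vec d f) $ i =
    (if i = d - 1 then - (\<Sum>j<d. a j * f j) / a d else f (i + 1))"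
proof -
  have "(transpose_mat (companion d a) *\<^sub>v vec d f) $ i = (\<Sum>j<d. transpose_mat (companion d a) $$ (i, j) * f j)"
    using assms by (subst mult_mat_vec_index[of _ d]) auto
  also have "\<dots> = (\<Sum>j<d. if i = d - 1 then - (a j * f j) / a d else if j = i + 1 then f j else 0)"
    using assms by (intro sum.cong) (auto simp: companion_def)
  also have "\<dots> = (if i = d - 1 then - (\<Sum>j<d. a j * f j) / a d else f (i + 1))"
    using assms by (auto simp: sum_negf sum.delta simp flip: sum_divide_distrib)
  finally show ?thesis .
qed

text \<open>Undoing the inverse Frobenius in each coordinate leaves a recursion starting from
  \<open>f 0\<close> and one closing condition from the last coordinate.\<close>

lemma comp_map_fixed_iff:
  assumes "y \<noteq> 0" "d \<ge> 1"
  shows "comp_map d a y f = f \<longleftrightarrow> (\<forall>i\<ge>d. f i = 0) \<and> (\<forall>i. i + 1 < d \<longrightarrow> f (i + 1) = y * \<sigma> (f i))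
    \<and> - (\<Sum>j<d. a j * f j) / a d = y * \<sigma> (f (d - 1))"
proof -
  have inv: "frob q (s_inv) x = z \<longleftrightarrow> x = \<sigma> z" for x z
    using frob_cancel[of 1] by (metis mult_1_right)
  have "comp_map d a y f = f \<longleftrightarrow> (\<forall>i\<ge>d. f i = 0)
      \<and> (\<forall>i<d. (transpose_mat (companion d a) *\<^sub>v vec d f) $ i / y = \<sigma> (f i))"
    by (auto simp: comp_map_def fun_eq_iff inv not_less)
  also have "(\<forall>i<d. (transpose_mat (companion d a) *\<^sub>v vec d f) $ i / y = \<sigma> (f i)) \<longleftrightarrow>
     (\<forall>i<d. (if i = d - 1 then - (\<Sum>j<d. a j * f j) / a d else f (i + 1)) = y * \<sigma> (f i))"
    using assms(1) by (auto simp: companion_transpose_mult_index field_simps)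
  also have "\<dots> \<longleftrightarrow> (\<forall>i. i + 1 < d \<longrightarrow> f (i + 1) = y * \<sigma> (f i))
    \<and> - (\<Sum>j<d. a j * f j) / a d = y * \<sigma> (f (d - 1))"
  proof -
    obtain e where "d = Suc e" using assms(2) by (cases d) auto
    then show ?thesis by (auto simp: All_less_Suc)
  qed
  finally show ?thesis .
qed

text \<open>The recursion forces \<open>f i = br y i * \<sigma>^i (f 0)\<close>, so
  \<open>f 0\<close> determines \<open>f\<close>, and the closing condition becomes the root
  equation for \<open>f 0\<close>.\<close>

lemma card_fixed_comp_map:
  assumes "y \<noteq> 0" "d \<ge> 1" "a d \<noteq> 0"
  shows "card {f. comp_map d a y f = f} = card {x. (\<Sum>i\<le>d. a i * br y i * frob q (s * i) x) = 0}"
proof (rule bij_betw_same_card[of "\<lambda>f. f 0"],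
    rule bij_betw_byWitness[where f' = "\<lambda>x i. if i < d then br y i * frob q (s * i) x else 0"])
  let ?F = "{f. comp_map d a y f = f}" and ?Z = "{x. (\<Sum>i\<le>d. a i * br y i * frob q (s * i) x) = 0}"
  have step: "br y (Suc i) * frob q (s * Suc i) x = y * \<sigma> (br y i * frob q (s * i) x)" for i x
    by (simp add: br_Suc frob_mult frob_frob)
  \<comment> \<open>Solving for the top term, possible as \<open>a d \<noteq> 0\<close>, gives the
    shape of the closing condition.\<close>
  have sum0: "(\<Sum>i\<le>d. a i * br y i * frob q (s * i) x) = 0 \<longleftrightarrow>
    - (\<Sum>j<d. a j * (br y j * frob q (s * j) x)) / a d = br y d * frob q (s * d) x" for x
  proof -
    have "(\<Sum>i\<le>d. a i * br y i * frob q (s * i) x)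
      = (\<Sum>j<d. a j * (br y j * frob q (s * j) x)) + a d * (br y d * frob q (s * d) x)"
      by (simp add: lessThan_Suc_atMost[symmetric] mult.assoc)
    moreover have "u + a d * v = 0 \<longleftrightarrow> - u / a d = v" for u v
      unfolding divide_eq_eq neg_eq_iff_add_eq_0 using assms(3) by (simp add: mult.commute)
    ultimately show ?thesis by (simp only:)
  qed
  have F: "f i = br y i * frob q (s * i) (f 0)" if "f \<in> ?F" "i < d" for f i
    using that(2)
  proof (induction i)
    case (Suc i)
    then show ?case using that(1) step[of i "f 0"] by (simp add: comp_map_fixed_iff[OF assms(1,2)])
  qed (simp add: frob_def)
  show "\<forall>f\<in>?F. (\<lambda>i. if i < d then br y i * frob q (s * i) (f 0) else 0) = f"
  proof (intro ballI ext)
    fix f i assume f: "f \<in> ?F"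
    show "(if i < d then br y i * frob q (s * i) (f 0) else 0) = f i"
    proof (cases "i < d")
      case True
      then show ?thesis using F[OF f True, symmetric] by simp
    next
      case False
      then show ?thesis using f by (simp add: comp_map_fixed_iff[OF assms(1,2)])
    qed
  qed
  show "\<forall>x\<in>?Z. (if 0 < d then br y 0 * frob q (s * 0) x else 0) = x"
    using assms(2) by (auto simp: frob_def)
  \<comment> \<open>Because \<open>d \<ge> 1\<close>, the top term is one more recursion step after
    the last coordinate.\<close>
  have last: "br y d * frob q (s * d) x = y * \<sigma> (br y (d - 1) * frob q (s * (d - 1)) x)" for x
    using step[of "d - 1" x] assms(2) by simp
  show "(\<lambda>f. f 0) ` ?F \<subseteq> ?Z"
  proof
    fix x assume "x \<in> (\<lambda>f. f 0) ` ?F"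
    then obtain f where f: "f \<in> ?F" "x = f 0" by blast
    have "- (\<Sum>j<d. a j * f j) / a d = y * \<sigma> (f (d - 1))"
      using f(1) by (simp add: comp_map_fixed_iff[OF assms(1,2)])
    moreover have "(\<Sum>j<d. a j * f j) = (\<Sum>j<d. a j * (br y j * frob q (s * j) x))"
      by (intro sum.cong refl arg_cong2[where f = "(*)"]) (simp add: F[OF f(1), folded f(2)])
    moreover have "f (d - 1) = br y (d - 1) * frob q (s * (d - 1)) x"
      using F[OF f(1), of "d - 1", folded f(2)] assms(2) by simp
    ultimately show "x \<in> ?Z" by (simp only: mem_Collect_eq sum0 last)
  qed
  show "(\<lambda>x i. if i < d then br y i * frob q (s * i) x else 0) ` ?Z \<subseteq> ?F"
  proof
    fix f assume "f \<in> (\<lambda>x i. if i < d then br y i * frob q (s * i) x else 0) ` ?Z"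
    then obtain x where x: "x \<in> ?Z" and f: "f = (\<lambda>i. if i < d then br y i * frob q (s * i) x else 0)"
      by blast
    have "(\<Sum>j<d. a j * f j) = (\<Sum>j<d. a j * (br y j * frob q (s * j) x))"
      by (intro sum.cong) (auto simp: f)
    moreover have "f (d - 1) = br y (d - 1) * frob q (s * (d - 1)) x"
      using assms(2) by (simp add: f)
    ultimately have "- (\<Sum>j<d. a j * f j) / a d = y * \<sigma> (f (d - 1))"
      using x by (simp only: mem_Collect_eq sum0 last)
    moreover have "f (i + 1) = y * \<sigma> (f i)" if "i + 1 < d" for i
      using that step[of i x] by (simp add: f)
    moreover have "f i = 0" if "i \<ge> d" for i using that by (simp add: f)
    ultimately show "f \<in> ?F" by (simp only: mem_Collect_eq comp_map_fixed_iff[OF assms(1,2)]) simp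
  qed
qed

text \<open>The \<open>n\<close>-th powers of both sides are the size of the eigenspace: on the left
  by descent, on the right because the field has \<open>q ^ n\<close> elements.\<close>

lemma card_linear_roots:
  assumes "y \<noteq> 0" "d \<ge> 1" "a d \<noteq> 0"
  shows "card {x. (\<Sum>i\<le>d. a i * br y i * frob q (s * i) x) = 0}
    = q ^ eigenspace_dim (A_mat q n s d a) (norm_n y)"
proof -
  \<comment> \<open>\<open>comp_map\<close> is semilinear for the inverse Frobenius, so descent is
    needed with exponent \<open>s_inv\<close>, which is again coprime to \<open>n\<close>.\<close>
  interpret inv: frobenius_field q n s_inv "TYPE('a)"
  proof
    have "coprime (n - 1) n" using n by (intro coprime_diff_one_left_nat) simp
    then show "coprime s_inv n" using coprime by (simp add: s_inv_def)
  qed (use q n card_field in auto)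
  let ?scale = "\<lambda>(c :: 'a) (f :: nat \<Rightarrow> 'a) i. c * f i"
  have "vector_space ?scale" by standard (auto simp: fun_eq_iff algebra_simps)
  moreover have "comp_map d a y (f + g) = comp_map d a y f + comp_map d a y g" for f g
  proof -
    have "(transpose_mat (companion d a) *\<^sub>v vec d (f + g)) $ i =
      (transpose_mat (companion d a) *\<^sub>v vec d f) $ i + (transpose_mat (companion d a) *\<^sub>v vec d g) $ i" if "i < d" for i
      using that by (simp add: mult_mat_vec_index[of _ d] sum.distrib algebra_simps del: index_mult_mat_vec)
    then show ?thesis by (auto simp: comp_map_def fun_eq_iff add_divide_distrib frob_add)
  qed
  moreover have "comp_map d a y (?scale c f) = ?scale (frob q s_inv c) (comp_map d a y f)" for c f
  proof -
    have "(transpose_mat (companion d a) *\<^sub>v vec d (?scale c f)) $ i =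
      c * (transpose_mat (companion d a) *\<^sub>v vec d f) $ i" if "i < d" for i
      using that by (simp add: mult_mat_vec_index[of _ d] sum_distrib_left algebra_simps del: index_mult_mat_vec)
    then show ?thesis by (auto simp: comp_map_def fun_eq_iff frob_mult[symmetric])
  qed
  ultimately have "card {f. (comp_map d a y ^^ n) f = f} = card {f. comp_map d a y f = f} ^ n"
    using card_fixed_comp_map_funpow(2)[OF assms(1)]
    by (rule inv.card_fixed_points_semilinear)
  then have "card {x. (\<Sum>i\<le>d. a i * br y i * frob q (s * i) x) = 0} ^ n
    = (q ^ eigenspace_dim (A_mat q n s d a) (norm_n y)) ^ n"
    unfolding card_fixed_comp_map[where a = a, OF assms] card_fixed_comp_map_funpow(1)[OF assms(1)]
      card_eigenspace[OF transpose_A_mat(2)] card_field power_mult[symmetric]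
    by (simp only: mult.commute)
  then show ?thesis by (rule power_eq_imp_eq_base) (use n in simp_all)
qed

text \<open>The companion matrix is injective because \<open>a 0 \<noteq> 0\<close>, hence so is the
  product. This settles the summand at 0, which is not the norm of a nonzero element.\<close>

lemma eigenspace_dim_0:
  fixes a :: "nat \<Rightarrow> 'a"
  assumes "d \<ge> 1" "a d \<noteq> 0" "a 0 \<noteq> 0"
  shows "eigenspace_dim (A_mat q n s d a) 0 = 0"
proof -
  \<comment> \<open>The shift kills every coordinate except \<open>f 0\<close>; the last coordinate
    then reads \<open>a 0 * f 0 = 0\<close>.\<close>
  have inj1: "f = (\<lambda>_. 0)" if "comp_map d a 1 f = (\<lambda>_. 0)" and supp: "\<And>i. i \<ge> d \<Longrightarrow> f i = 0" for f
  proof -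
    have z: "(if i = d - 1 then - (\<Sum>j<d. a j * f j) / a d else f (i + 1)) = 0" if "i < d" for i
      using fun_cong[OF \<open>comp_map d a 1 f = (\<lambda>_. 0)\<close>, of i] that by (simp add: comp_map_def companion_transpose_mult_index)
    have pos: "f i = 0" if "i \<noteq> 0" for i
    proof (cases "i < d")
      case True
      then have "i - 1 < d" "i - 1 \<noteq> d - 1" "i - 1 + 1 = i" using that by auto
      then show ?thesis using z[of "i - 1"] by (simp only: if_False)
    qed (simp add: supp)
    have "(\<Sum>j<d. a j * f j) = a 0 * f 0"
      using assms(1) by (subst sum.remove[of _ 0]) (auto intro!: sum.neutral simp: pos)
    then have "f 0 = 0" using z[of "d - 1"] assms by simp
    with pos show ?thesis by (metis)
  qed
  have inj: "f = (\<lambda>_. 0)" if "(comp_map d a 1 ^^ k) f = (\<lambda>_. 0)" and supp: "\<And>i. i \<ge> d \<Longrightarrow> f i = 0" for k f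
    using that(1)
  proof (induction k)
    case (Suc k)
    have "(comp_map d a 1 ^^ k) f = (\<lambda>_. 0)"
    proof (rule inj1)
      show "comp_map d a 1 ((comp_map d a 1 ^^ k) f) = (\<lambda>_. 0)" using Suc.prems by simp
      show "(comp_map d a 1 ^^ k) f i = 0" if "i \<ge> d" for i
        using that by (subst comp_map_funpow) (auto simp: supp)
    qed
    then show ?case by (rule Suc.IH)
  qed simp
  have "eigenspace (tprod d a n) 0 = {0\<^sub>v d}"
  proof
    have dim: "dim_row (tprod d a n) = d" "dim_col (tprod d a n) = d"
      using carrier_matD[OF tprod_carrier[of d a n]] by auto
    show "{0\<^sub>v d} \<subseteq> eigenspace (tprod d a n) 0"
      using dim by (auto simp: eigenspace_def vec_eq_iff)
    show "eigenspace (tprod d a n) 0 \<subseteq> {0\<^sub>v d}"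
    proof
      fix u assume "u \<in> eigenspace (tprod d a n) 0"
      then have u: "u \<in> carrier_vec d" "tprod d a n *\<^sub>v u = 0 \<cdot>\<^sub>v u"
        by (auto simp: eigenspace_def dim)
      define f where "f = (\<lambda>i. if i < d then u $ i else 0)"
      have vf: "vec d f = u" using u(1) by (auto simp: f_def)
      \<comment> \<open>At \<open>y = 1\<close> all divisors are 1, so the \<open>n\<close>-th
        iterate is the action of \<open>tprod d a n\<close> itself.\<close>
      have "(comp_map d a 1 ^^ n) f = (\<lambda>_. 0)"
        using u(1) by (subst comp_map_funpow) (auto simp: fun_eq_iff f_def vf[unfolded f_def] u(2))
      then have "f = (\<lambda>_. 0)" by (rule inj) (simp add: f_def)
      then have "u = vec d (\<lambda>_. 0)" using vf by simp
      then show "u \<in> {0\<^sub>v d}" by (simp add: zero_vec_def)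
    qed
  qed
  then have "card (eigenspace (A_mat q n s d a) 0) = 1"
    using card_eigenspace_transpose[OF transpose_A_mat(2), of d a 0] by (simp add: transpose_A_mat(1))
  then have "(q ^ n) ^ eigenspace_dim (A_mat q n s d a) 0 = 1"
    by (simp add: card_eigenspace[OF transpose_A_mat(2)] card_field)
  then show ?thesis using n q_ge_2 by simp
qed

section \<open>Evaluation of both polynomials and the final counts\<close>

lemma poly_lin_poly: "poly (lin_poly q s d a) x = (\<Sum>i\<le>d. a i * br 1 i * frob q (s * i) (x :: 'a))"
  by (simp add: lin_poly_def poly_sum poly_monom frob_def)

lemma poly_proj_poly: "poly (proj_poly q s d a) y = (\<Sum>i\<le>d. a i * br (y :: 'a) i)"
  by (simp add: proj_poly_def poly_sum poly_monom br_exp_def br_def frob_def power_sum)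

end

theorem theorem6:
  fixes q n s d :: nat
    and F :: "'a :: {field, finite} set"
    and a :: "nat \<Rightarrow> 'a"
  assumes "primepow q"
    and "n \<ge> 1"
    and "card (UNIV :: 'a set) = q ^ n"
    and "subfield F (class_ring :: 'a ring)"
    and "card F = q"
    and "coprime s n"
    and "d \<ge> 1"
    and "a d \<noteq> 0"
    and "a 0 \<noteq> 0"
  shows "real (card {y. poly (proj_poly q s d a) y = 0}) =
           (\<Sum>k\<in>F. (real q ^ eigenspace_dim (A_mat q n s d a) k - 1) / (real q - 1))
       \<and> card {x. poly (lin_poly q s d a) x = 0} = q ^ eigenspace_dim (A_mat q n s d a) 1"
proof
  interpret frobenius_field q n s "TYPE('a)" using assms by unfold_locales
  let ?A = "A_mat q n s d a"
  let ?R = "{y. poly (proj_poly q s d a) y = 0}"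
  show "card {x. poly (lin_poly q s d a) x = 0} = q ^ eigenspace_dim ?A 1"
    using card_linear_roots[of 1 d a] assms(7-9) by (simp only: poly_lin_poly br_1) simp
  have "card ?R * (q - 1) = (\<Sum>l\<in>{x. \<sigma> x = x} - {0}. q ^ eigenspace_dim ?A l - 1)"
    unfolding poly_proj_poly using assms(7-9) by (intro card_proj_roots card_linear_roots) auto
  also have "{x. \<sigma> x = x} = F" using fixed_field[OF assms(4,5)] by simp
  finally have "real (card ?R) * real (q - 1) = real (\<Sum>l\<in>F - {0}. q ^ eigenspace_dim ?A l - 1)"
    by (metis of_nat_mult)
  \<comment> \<open>Truncated subtraction agrees with real subtraction here, since powers of
    \<open>q\<close> are at least 1.\<close>
  then have "real (card ?R) * (real q - 1) = (\<Sum>l\<in>F - {0}. real q ^ eigenspace_dim ?A l - 1)"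
    using q_ge_2 by (simp add: of_nat_diff)
  \<comment> \<open>The eigenvalue 0 contributes \<open>q^0 - 1 = 0\<close>.\<close>
  also have "\<dots> = (\<Sum>l\<in>F. real q ^ eigenspace_dim ?A l - 1)"
    using eigenspace_dim_0[of d a] assms(7-9) by (intro sum.mono_neutral_left) auto
  finally show "real (card ?R) = (\<Sum>k\<in>F. (real q ^ eigenspace_dim ?A k - 1) / (real q - 1))"
    using q_ge_2 by (simp add: field_simps flip: sum_divide_distrib)
qed

end
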